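(* Let $\rho_0\in L^\infty(\mathbb{R};[0,1])$ and let the following CFL condition hold: $$\Delta t\le\min\left\{\frac{\Delta x}{\gamma_0\|v'\|_{L^\infty([0,1])}+\|v\|_{L^\infty([0,1])}},\ \frac{L}{\|q_{\mathrm{on}}\|_{L^\infty([0,T])}+\|q_{\mathrm{off}}\|_{L^\infty([0,T])}}\right\}.$$ Then the piecewise constant approximate solution $\rho_\Delta$ constructed by the scheme in the context (Model 2) satisfies $0\le\rho_\Delta(t,x)\le1$ for all $t\in[0,T]$ and $x\in\mathbb{R}$.
   Context: Assumptions. $T>0$; $q_{\mathrm{on}},q_{\mathrm{off}}\in L^\infty(\mathbb{R}^+;\mathbb{R}^+)$; $v\in C^2(\mathbb{R};[0,1])$, $v'\le 0$; $\eta\in(0,1]$, $\delta\in[-\eta,\eta]$; $\omega_\eta\in C^1([0,\eta];\mathbb{R}^+)$, $\omega_\eta'\le 0$, $\int_0^\eta\omega_\eta=1$; $\omega_{\eta,\delta}\in C^1([\delta-\eta,\delta+\eta];\mathbb{R}^+)$, $\omega_{\eta,\delta}'\ge0$ on $[\delta-\eta,0]$, $\omega_{\eta,\delta}'\le0$ on $[0,\delta+\eta]$, $\int_{\delta-\eta}^{\delta+\eta}\omega_{\eta,\delta}=1$ ($\omega_{\eta,\delta}$ is extended by $0$ outside its interval). Mesh. $\Delta x>0$ with $\eta=N\Delta x$, $N\in\mathbb{N}$; $\Delta t>0$, $\lambda=\Delta t/\Delta x$; $x_{j-1/2}=j\Delta x$, $x_j=(j+\tfrac12)\Delta x$ for $j\in\mathbb{Z}$;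 $t^n=n\Delta t$; $N_T\in\mathbb{N}$ with $N_T\Delta t\le T<(N_T+1)\Delta t$. The ramps are $\Omega_{\mathrm{on}}=[\underline{x}_{\mathrm{on}},\overline{x}_{\mathrm{on}}]=[x_{\underline{k}_{\mathrm{on}}+1/2},x_{\underline{k}_{\mathrm{on}}+1/2+\ell}]$, $\Omega_{\mathrm{off}}=[\underline{x}_{\mathrm{off}},\overline{x}_{\mathrm{off}}]=[x_{\underline{k}_{\mathrm{off}}+1/2},x_{\underline{k}_{\mathrm{off}}+1/2+\ell}]$ with $\underline{k}_{\mathrm{on}},\underline{k}_{\mathrm{off}}\in\mathbb{Z}$, $\ell\in\mathbb{Z}^+$, length $L=\ell\Delta x$. $\mathbf{1}_{\mathrm{on},j}=1/L$ if $x_j\in\Omega_{\mathrm{on}}$ and $0$ otherwise; $\mathbf{1}_{\mathrm{off},j}=1/L$ if $x_j\in\Omega_{\mathrm{off}}$ and $0$ otherwise. Discrete data. $\rho_j^0=\frac1{\Delta x}\int_{x_{j-1/2}}^{x_{j+1/2}}\rho_0\,dx$; $q_{\mathrm{on}}^{n+1/2}=\frac1{\Delta t}\int_{t^n}^{t^{n+1}}q_{\mathrm{on}}\,dt$, $q_{\mathrm{off}}^{n+1/2}=\frac1{\Delta t}\int_{t^n}^{t^{n+1}}q_{\mathrm{off}}\,dt$; $\gamma_p=\int_{p\Delta x}^{(p+1)\Delta x}\omega_\eta(y)\,dy$ for $0\le p\le N-1$; $\hat\gamma_h=\int_{h\Delta x}^{(h+1)\Delta x}\omega_{\eta,\delta}(y)\,dy$.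 Scheme, for $n=0,\dots,N_T-1$, $j\in\mathbb{Z}$: $R_{j+1/2}^n=\sum_{p=0}^{N-1}\gamma_p\rho_{j+p+1}^n$, $\rho_j^{n+1/2}=\rho_j^n-\lambda\big(\rho_j^nv(R_{j+1/2}^n)-\rho_{j-1}^nv(R_{j-1/2}^n)\big)$, $R_{\mathrm{on},j}^{n+1/2}=\sum_{h=\lfloor(\delta-\eta)/\Delta x\rfloor}^{\lfloor(\delta+\eta)/\Delta x\rfloor-1}\hat\gamma_h\rho_{j+h}^{n+1/2}$, and (Model 2) $\rho_j^{n+1}=\rho_j^{n+1/2}+\Delta t\,\mathbf{1}_{\mathrm{on},j}q_{\mathrm{on}}^{n+1/2}\big(1-\max\{\rho_j^{n+1/2},R_{\mathrm{on},j}^{n+1/2}\}\big)-\Delta t\,\mathbf{1}_{\mathrm{off},j}q_{\mathrm{off}}^{n+1/2}\rho_j^{n+1/2}$. Approximate solution: $\rho_\Delta(t,x)=\rho_j^n$ for $t\in[t^n,t^{n+1}[\,\cap[0,T]$, $x\in\,]x_{j-1/2},x_{j+1/2}]$, $n=0,\dots,N_T$, $j\in\mathbb{Z}$. *)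

theory Defs
  imports "HOL-Analysis.Analysis" "HOL-Probability.Essential_Supremum"
begin

section \<open>Function spaces\<close>

text \<open>The norm is an extended real, so that in a bound of the form \<open>c / norm\<close> with
  \<open>c > 0\<close> a vanishing norm gives \<open>\<infinity>\<close>, i.e. no restriction.\<close>

definition Linf_norm :: "real set \<Rightarrow> (real \<Rightarrow> real) \<Rightarrow> ereal" where
  "Linf_norm S f = esssup (lebesgue_on S) (\<lambda>x. ereal \<bar>f x\<bar>)"

definition Linf :: "real set \<Rightarrow> real set \<Rightarrow> (real \<Rightarrow> real) set" where
  "Linf S B = {f \<in> borel_measurable (lebesgue_on S).
                 (AE x in lebesgue_on S. f x \<in> B) \<and> Linf_norm S f < \<infinity>}"

text \<open>Derivatives relative to \<open>S\<close>, so that they are one-sided at the end points of an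
  interval; values of \<open>f\<close> outside \<open>S\<close> are irrelevant.\<close>

definition deriv_on :: "real set \<Rightarrow> (real \<Rightarrow> real) \<Rightarrow> real \<Rightarrow> real" where
  "deriv_on S f x = vector_derivative f (at x within S)"

primrec Ck_on :: "nat \<Rightarrow> real set \<Rightarrow> (real \<Rightarrow> real) \<Rightarrow> bool" where
  "Ck_on 0 S f \<longleftrightarrow> continuous_on S f"
| "Ck_on (Suc k) S f \<longleftrightarrow> f differentiable_on S \<and> Ck_on k S (deriv_on S f)"


section \<open>Mesh and discrete data\<close>

text \<open>\<open>x\<^sub>j\<^sub>-\<^sub>1\<^sub>/\<^sub>2 = j \<Delta>x\<close> is the left end point of cell \<open>j\<close>;
  hence \<open>x\<^sub>j\<^sub>+\<^sub>1\<^sub>/\<^sub>2\<close> is \<open>xface dx (j + 1)\<close>.\<close>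

definition xface :: "real \<Rightarrow> int \<Rightarrow> real" where
  "xface dx j = real_of_int j * dx"

definition xmid :: "real \<Rightarrow> int \<Rightarrow> real" where
  "xmid dx j = (real_of_int j + 1/2) * dx"

text \<open>The ramp \<open>[x\<^sub>k\<^sub>+\<^sub>1\<^sub>/\<^sub>2, x\<^sub>k\<^sub>+\<^sub>1\<^sub>/\<^sub>2\<^sub>+\<^sub>l]\<close>.\<close>

definition ramp :: "real \<Rightarrow> int \<Rightarrow> int \<Rightarrow> real set" where
  "ramp dx l k = {xface dx (k + 1) .. xface dx (k + 1 + l)}"

definition ramp_length :: "real \<Rightarrow> int \<Rightarrow> real" where
  "ramp_length dx l = real_of_int l * dx"

definition ramp_ind :: "real \<Rightarrow> int \<Rightarrow> int \<Rightarrow> int \<Rightarrow> real" where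
  "ramp_ind dx l k j = (if xmid dx j \<in> ramp dx l k then 1 / ramp_length dx l else 0)"

definition cell_average :: "real \<Rightarrow> (real \<Rightarrow> real) \<Rightarrow> int \<Rightarrow> real" where
  "cell_average dx f j =
     1 / dx * set_lebesgue_integral lebesgue {xface dx j .. xface dx (j + 1)} f"

text \<open>\<open>q\<^sup>n\<^sup>+\<^sup>1\<^sup>/\<^sup>2\<close>\<close>

definition time_average :: "real \<Rightarrow> (real \<Rightarrow> real) \<Rightarrow> nat \<Rightarrow> real" where
  "time_average dt q n =
     1 / dt * set_lebesgue_integral lebesgue {real n * dt .. real (n + 1) * dt} q"

text \<open>\<open>\<gamma>\<^sub>p\<close>\<close>

definition conv_weight :: "real \<Rightarrow> (real \<Rightarrow> real) \<Rightarrow> nat \<Rightarrow> real" where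
  "conv_weight dx w p = set_lebesgue_integral lebesgue {real p * dx .. real (p + 1) * dx} w"

text \<open>The weight for the on-ramp, with the kernel \<open>w\<close> extended by zero outside
  \<open>[\<delta> - \<eta>, \<delta> + \<eta>]\<close>.\<close>

definition ramp_weight :: "real \<Rightarrow> real \<Rightarrow> real \<Rightarrow> (real \<Rightarrow> real) \<Rightarrow> int \<Rightarrow> real" where
  "ramp_weight dx \<eta> \<delta> w h =
     set_lebesgue_integral lebesgue {real_of_int h * dx .. real_of_int (h + 1) * dx}
       (\<lambda>y. if y \<in> {\<delta> - \<eta> .. \<delta> + \<eta>} then w y else 0)"


section \<open>The scheme\<close>

text \<open>\<open>R\<^sub>j\<^sub>+\<^sub>1\<^sub>/\<^sub>2\<close>, indexed by \<open>j\<close>\<close>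

definition R_down :: "real \<Rightarrow> nat \<Rightarrow> (real \<Rightarrow> real) \<Rightarrow> (int \<Rightarrow> real) \<Rightarrow> int \<Rightarrow> real" where
  "R_down dx N w r j = (\<Sum>p<N. conv_weight dx w p * r (j + int p + 1))"

text \<open>From \<open>\<rho>\<^sup>n\<close> to \<open>\<rho>\<^sup>n\<^sup>+\<^sup>1\<^sup>/\<^sup>2\<close>\<close>

definition transport_step ::
  "real \<Rightarrow> real \<Rightarrow> nat \<Rightarrow> (real \<Rightarrow> real) \<Rightarrow> (real \<Rightarrow> real) \<Rightarrow> (int \<Rightarrow> real) \<Rightarrow> int \<Rightarrow> real" where
  "transport_step dx dt N w v r j =
     r j - dt / dx * (r j * v (R_down dx N w r j) - r (j - 1) * v (R_down dx N w r (j - 1)))"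

definition R_on ::
  "real \<Rightarrow> real \<Rightarrow> real \<Rightarrow> (real \<Rightarrow> real) \<Rightarrow> (int \<Rightarrow> real) \<Rightarrow> int \<Rightarrow> real" where
  "R_on dx \<eta> \<delta> w r j =
     (\<Sum>h = \<lfloor>(\<delta> - \<eta>) / dx\<rfloor> .. \<lfloor>(\<delta> + \<eta>) / dx\<rfloor> - 1. ramp_weight dx \<eta> \<delta> w h * r (j + h))"

text \<open>From \<open>\<rho>\<^sup>n\<^sup>+\<^sup>1\<^sup>/\<^sup>2\<close> to \<open>\<rho>\<^sup>n\<^sup>+\<^sup>1\<close>;
  \<open>a\<close> and \<open>b\<close> are the on- and off-ramp rates \<open>q\<^sup>n\<^sup>+\<^sup>1\<^sup>/\<^sup>2\<close>.\<close>

definition source_step ::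
  "real \<Rightarrow> real \<Rightarrow> real \<Rightarrow> real \<Rightarrow> (real \<Rightarrow> real) \<Rightarrow> int \<Rightarrow> int \<Rightarrow> int \<Rightarrow> real \<Rightarrow> real
    \<Rightarrow> (int \<Rightarrow> real) \<Rightarrow> int \<Rightarrow> real" where
  "source_step dx dt \<eta> \<delta> w l k_on k_off a b r j =
     r j + dt * ramp_ind dx l k_on j * a * (1 - max (r j) (R_on dx \<eta> \<delta> w r j))
         - dt * ramp_ind dx l k_off j * b * r j"

primrec model2_density ::
  "real \<Rightarrow> real \<Rightarrow> nat \<Rightarrow> real \<Rightarrow> real \<Rightarrow> (real \<Rightarrow> real) \<Rightarrow> (real \<Rightarrow> real) \<Rightarrow> (real \<Rightarrow> real)
    \<Rightarrow> int \<Rightarrow> int \<Rightarrow> int \<Rightarrow> (real \<Rightarrow> real) \<Rightarrow> (real \<Rightarrow> real) \<Rightarrow> (real \<Rightarrow> real)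
    \<Rightarrow> nat \<Rightarrow> int \<Rightarrow> real" where
  "model2_density dx dt N \<eta> \<delta> w w_on v l k_on k_off q_on q_off \<rho>\<^sub>0 0 = cell_average dx \<rho>\<^sub>0"
| "model2_density dx dt N \<eta> \<delta> w w_on v l k_on k_off q_on q_off \<rho>\<^sub>0 (Suc n) =
     source_step dx dt \<eta> \<delta> w_on l k_on k_off (time_average dt q_on n) (time_average dt q_off n)
       (transport_step dx dt N w v
         (model2_density dx dt N \<eta> \<delta> w w_on v l k_on k_off q_on q_off \<rho>\<^sub>0 n))"

text \<open>\<open>u\<close> is the piecewise constant function on \<open>[0,T] \<times> \<real>\<close> with cell values
  \<open>r\<close>. For \<open>0 < dx\<close> and \<open>N\<^sub>T dt \<le> T < (N\<^sub>T + 1) dt\<close> the cells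
  partition \<open>[0,T] \<times> \<real>\<close>, so \<open>u\<close> exists and is unique there.\<close>

definition piecewise_constant ::
  "real \<Rightarrow> real \<Rightarrow> real \<Rightarrow> nat \<Rightarrow> (nat \<Rightarrow> int \<Rightarrow> real) \<Rightarrow> (real \<Rightarrow> real \<Rightarrow> real) \<Rightarrow> bool" where
  "piecewise_constant T dx dt N\<^sub>T r u \<longleftrightarrow>
     (\<forall>n\<le>N\<^sub>T. \<forall>j. \<forall>t\<in>{real n * dt ..< real (n + 1) * dt} \<inter> {0..T}.
        \<forall>x\<in>{xface dx j <.. xface dx (j + 1)}. u t x = r n j)"

end

theory Submission
  imports Defs
begin

text \<open>
  Each time step maps densities with values in \<open>[0,1]\<close> to densities with values in \<open>[0,1]\<close>;
  since the cell averages of \<open>\<rho>\<^sub>0\<close> lie in that interval, the bound follows by induction on the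
  time level. The transport step and the source step preserve the interval separately, each thanks
  to one half of the CFL condition.

  Transport: with \<open>V\<^sub>j = v (R\<^sub>j\<^sub>+\<^sub>1\<^sub>/\<^sub>2)\<close> and \<open>\<kappa> = dt / dx\<close> the new value is
  \<open>(1 - \<kappa> V\<^sub>j) r\<^sub>j + \<kappa> V\<^sub>j\<^sub>-\<^sub>1 r\<^sub>j\<^sub>-\<^sub>1\<close>, so positivity only needs \<open>\<kappa> V\<^sub>j \<le> 1\<close>. The coefficients do
  not add up to one, and the excess \<open>\<kappa> (V\<^sub>j\<^sub>-\<^sub>1 - V\<^sub>j)\<close> has to be controlled near \<open>r\<^sub>j = 1\<close>. The
  decisive estimate is that it cannot be positive there: because the kernel decreases, its weights \<open>\<gamma>\<^sub>p\<close>
  decrease, and summation by parts shows that moving the window one cell downstream raises the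
  convolution by at most \<open>\<gamma>\<^sub>0 (1 - r\<^sub>j)\<close> (\<open>R_down_increment_le\<close>). As \<open>v\<close> is nonincreasing and
  Lipschitz on \<open>[0,1]\<close>, this gives \<open>V\<^sub>j\<^sub>-\<^sub>1 - V\<^sub>j \<le> \<parallel>v'\<parallel> \<gamma>\<^sub>0 (1 - r\<^sub>j)\<close>, and the new value is at
  most \<open>r\<^sub>j + \<kappa> (\<gamma>\<^sub>0 \<parallel>v'\<parallel> + \<parallel>v\<parallel>) (1 - r\<^sub>j) \<le> 1\<close> (\<open>transport_step_in_unit\<close>).

  Source: on a ramp the scheme adds a fraction at most one of \<open>1 - max r\<^sub>j R \<le> 1 - r\<^sub>j\<close> and removes
  a fraction at most one of \<open>r\<^sub>j\<close>. What is added is nonnegative since \<open>R \<le> 1\<close>, that is, since the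
  weights of the on-ramp kernel have total mass at most one (\<open>R_on_le\<close>,
  \<open>source_step_in_unit\<close>).

  The rest relates the essential suprema in the CFL condition to the bounds used above: for the
  continuous functions \<open>v\<close> and \<open>v'\<close> they bound every value on \<open>[0,1]\<close>, and for the ramp rates they
  bound the time averages over the steps contained in \<open>[0,T]\<close>.
\<close>

section \<open>Integrals over intervals and cells\<close>

text \<open>This estimate serves three times: for the cell averages of the datum, for the time averages
  of the ramp rates, and for comparing consecutive weights of the decreasing kernel, where
  \<open>c\<close> and \<open>d\<close> are the end point values of the kernel on a cell.\<close>

lemma set_integral_Icc_bounds:
  fixes f :: "real \<Rightarrow> real"
  assumes "a \<le> b" and f: "f \<in> borel_measurable (lebesgue_on {a..b})"
    and bd: "AE x in lebesgue_on {a..b}. c \<le> f x \<and> f x \<le> d"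
  shows "c * (b - a) \<le> (LINT x:{a..b}|lebesgue. f x)"
    and "(LINT x:{a..b}|lebesgue. f x) \<le> d * (b - a)"
proof -
  let ?M = "lebesgue_on {a..b}"
  have fin: "emeasure ?M (space ?M) = ennreal (b - a)"
    using assms(1) by (simp add: emeasure_restrict_space)
  interpret finite_measure ?M
    by (rule finite_measureI) (use fin in simp)
  have m: "measure ?M (space ?M) = b - a"
    using fin assms(1) by (simp add: measure_def)
  have int: "integrable ?M f"
  proof (rule integrable_const_bound[OF _ f])
    show "AE x in ?M. norm (f x) \<le> max \<bar>c\<bar> \<bar>d\<bar>"
      using bd by eventually_elim auto
  qed
  have eq: "(LINT x:{a..b}|lebesgue. f x) = integral\<^sup>L ?M f"
    by (simp add: set_lebesgue_integral_def integral_restrict_space)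
  have "integral\<^sup>L ?M (\<lambda>_. c) \<le> integral\<^sup>L ?M f"
    by (rule integral_mono_AE) (use bd int in \<open>auto elim!: eventually_mono\<close>)
  then show "c * (b - a) \<le> (LINT x:{a..b}|lebesgue. f x)"
    using m by (simp add: eq mult.commute)
  have "integral\<^sup>L ?M f \<le> integral\<^sup>L ?M (\<lambda>_. d)"
    by (rule integral_mono_AE) (use bd int in \<open>auto elim!: eventually_mono\<close>)
  then show "(LINT x:{a..b}|lebesgue. f x) \<le> d * (b - a)"
    using m by (simp add: eq mult.commute)
qed

text \<open>The closed cells overlap in null sets only, so their integrals add up to an integral over the
  union. This bounds the total mass of both families of kernel weights, also when the cells do not
  exactly cover the support of the kernel.\<close>

lemma sum_cell_integrals_le:
  fixes g :: "real \<Rightarrow> real" and H :: "int set"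
  assumes "0 < dx" "finite H" and g: "integrable lebesgue g" "\<And>x. 0 \<le> g x"
  shows "(\<Sum>h\<in>H. LINT x:{real_of_int h * dx..real_of_int (h + 1) * dx}|lebesgue. g x)
    \<le> integral\<^sup>L lebesgue g"
proof -
  define C where "C h = {real_of_int h * dx<..real_of_int (h + 1) * dx}" for h
  have int: "set_integrable lebesgue A g" if "A \<in> sets lebesgue" for A
    using integrable_mult_indicator[OF that g(1)] by (simp add: set_integrable_def)
  have "(\<Sum>h\<in>H. LINT x:{real_of_int h * dx..real_of_int (h + 1) * dx}|lebesgue. g x)
      = (\<Sum>h\<in>H. LINT x:C h|lebesgue. g x)"
  proof (rule sum.cong)
    fix h
    (* Dropping the left end point makes the cells disjoint. *)
    show "(LINT x:{real_of_int h * dx..real_of_int (h + 1) * dx}|lebesgue. g x)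
        = (LINT x:C h|lebesgue. g x)"
      by (rule set_integral_discrete_difference[where X = "{real_of_int h * dx}"])
        (auto simp: C_def)
  qed simp
  also have "\<dots> = (LINT x:(\<Union>h\<in>H. C h)|lebesgue. g x)"
  proof (rule set_integral_finite_Union[symmetric, OF \<open>finite H\<close>])
    have "h = \<lceil>x / dx\<rceil> - 1" if "x \<in> C h" for x h
      using that \<open>0 < dx\<close> ceiling_unique[of "h + 1" "x / dx"]
      by (simp add: C_def field_simps)
    then show "disjoint_family_on C H"
      unfolding disjoint_family_on_def by blast
  qed (auto simp: C_def intro!: int)
  also have "\<dots> \<le> integral\<^sup>L lebesgue g"
  proof -
    have U: "(\<Union>h\<in>H. C h) \<in> sets lebesgue"
      using \<open>finite H\<close> by (auto simp: C_def)
    show ?thesis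
      unfolding set_lebesgue_integral_def
      by (rule integral_mono[OF int[OF U, unfolded set_integrable_def] g(1)])
        (auto simp: g(2) split: split_indicator)
  qed
  finally show ?thesis .
qed

lemma integral_zero_extension:
  fixes w :: "real \<Rightarrow> real"
  assumes "continuous_on {a..b} w"
  shows "integrable lebesgue (\<lambda>y. if y \<in> {a..b} then w y else 0)"
    and "integral\<^sup>L lebesgue (\<lambda>y. if y \<in> {a..b} then w y else 0) = (LINT y:{a..b}|lebesgue. w y)"
proof -
  have eq: "(\<lambda>y. if y \<in> {a..b} then w y else 0) = (\<lambda>y. indicator {a..b} y *\<^sub>R w y)"
    by (auto simp: fun_eq_iff)
  show "integrable lebesgue (\<lambda>y. if y \<in> {a..b} then w y else 0)"
    unfolding eq using absolutely_integrable_continuous_real[OF assms]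
    by (simp add: set_integrable_def)
  show "integral\<^sup>L lebesgue (\<lambda>y. if y \<in> {a..b} then w y else 0) = (LINT y:{a..b}|lebesgue. w y)"
    unfolding eq set_lebesgue_integral_def ..
qed

section \<open>Essential bounds\<close>

lemma AE_lebesgue_on_subset:
  assumes "AE x in lebesgue_on S. P x" "A \<subseteq> S" "S \<in> sets lebesgue" "A \<in> sets lebesgue"
  shows "AE x in lebesgue_on A. P x"
proof -
  have "AE x in lebesgue. x \<in> S \<longrightarrow> P x"
    using assms by (simp add: AE_restrict_space_iff)
  then have "AE x in lebesgue. x \<in> A \<longrightarrow> P x"
    by eventually_elim (use assms(2) in auto)
  then show ?thesis
    using assms by (simp add: AE_restrict_space_iff)
qed

text \<open>On a null set the essential supremum would be \<open>-\<infinity>\<close>; hence the nondegenerate interval.\<close>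

lemma Linf_norm_nonneg:
  assumes "a < b"
  shows "0 \<le> Linf_norm {a..b} f"
proof (cases "(\<lambda>x. ereal \<bar>f x\<bar>) \<in> borel_measurable (lebesgue_on {a..b})")
  case True
  have "emeasure (lebesgue_on {a..b}) (space (lebesgue_on {a..b})) \<noteq> 0"
    using assms by (simp add: emeasure_restrict_space)
  then have "0 = esssup (lebesgue_on {a..b}) (\<lambda>_. 0 :: ereal)"
    by (simp add: esssup_const)
  also have "\<dots> \<le> Linf_norm {a..b} f"
    unfolding Linf_norm_def by (rule esssup_mono) auto
  finally show ?thesis .
qed (simp add: Linf_norm_def esssup_non_measurable)

lemma AE_abs_le_of_Linf_norm_le:
  assumes "Linf_norm S f \<le> ereal c"
  shows "AE x in lebesgue_on S. \<bar>f x\<bar> \<le> c"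
  using esssup_AE[of "\<lambda>x. ereal \<bar>f x\<bar>" "lebesgue_on S"]
  by eventually_elim (use assms in \<open>auto simp: Linf_norm_def dest: order_trans\<close>)

text \<open>The set where the bound holds is closed by continuity and has full measure. A closed set of
  full measure in an open set contains it, which settles the open interval; the end points follow
  by taking the closure.\<close>

lemma abs_le_of_Linf_norm_le:
  assumes "a < b" "continuous_on {a..b} f" "Linf_norm {a..b} f \<le> ereal c" "x \<in> {a..b}"
  shows "\<bar>f x\<bar> \<le> c"
proof -
  have inner: "\<bar>f y\<bar> \<le> c" if y: "y \<in> {a<..<b}" for y
  proof -
    let ?S = "{x \<in> {a..b}. \<bar>f x\<bar> \<le> c}"
    have "AE x in lebesgue. x \<in> {a..b} \<longrightarrow> \<bar>f x\<bar> \<le> c"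
      using AE_abs_le_of_Linf_norm_le[OF assms(3)] by (simp add: AE_restrict_space_iff)
    then have ae: "AE x\<in>{a<..<b} in lebesgue. x \<in> ?S"
      by eventually_elim auto
    have "closed ?S"
      using assms(2) by (intro continuous_closed_preimage_constant
          continuous_on_closed_Collect_le continuous_intros) auto
    from mem_closed_if_AE_lebesgue_open[OF _ this ae y] show ?thesis
      by auto
  qed
  have "f ` closure {a<..<b} \<subseteq> {-c..c}"
    by (rule image_closure_subset) (use assms inner in \<open>auto simp: abs_le_iff minus_le_iff\<close>)
  then show ?thesis
    using assms(1,4) by (auto simp: image_subset_iff abs_le_iff minus_le_iff)
qed

lemma Linf_norm_finite_of_continuous:
  assumes "continuous_on {a..b} f"
  shows "Linf_norm {a..b} f < \<infinity>"
proof -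
  obtain B where B: "\<And>x. x \<in> {a..b} \<Longrightarrow> \<bar>f x\<bar> \<le> B"
    using compact_imp_bounded[OF compact_continuous_image[OF assms compact_Icc]]
    unfolding bounded_iff by (metis imageI real_norm_def)
  have "Linf_norm {a..b} f \<le> ereal B"
    unfolding Linf_norm_def
  proof (rule esssup_I)
    have "f \<in> borel_measurable (lebesgue_on {a..b})"
      using assms by (intro continuous_imp_measurable_on_sets_lebesgue) auto
    then show "(\<lambda>x. ereal \<bar>f x\<bar>) \<in> borel_measurable (lebesgue_on {a..b})"
      by measurable
  qed (use B in \<open>auto intro!: AE_I2\<close>)
  then show ?thesis
    by (rule le_less_trans) simp
qed

text \<open>The case \<open>a = 0\<close>, in which the quotient may be \<open>\<infinity>\<close>, is covered by \<open>0 \<le> c\<close>.\<close>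

lemma mult_le_of_le_ereal_divide:
  assumes "0 < t" "ereal t \<le> ereal c / ereal a" "0 \<le> a" "0 \<le> c"
  shows "t * a \<le> c"
  using assms by (cases "a = 0") (auto simp: field_simps)

section \<open>Averages and weights\<close>

lemma cell_average_in_unit:
  assumes "0 < dx" "\<rho>\<^sub>0 \<in> Linf UNIV {0..1}"
  shows "cell_average dx \<rho>\<^sub>0 j \<in> {0..1}"
proof -
  have le: "xface dx j \<le> xface dx (j + 1)" and d: "xface dx (j + 1) - xface dx j = dx"
    using assms(1) by (auto simp: xface_def algebra_simps)
  have m: "\<rho>\<^sub>0 \<in> borel_measurable (lebesgue_on {xface dx j..xface dx (j + 1)})"
    using assms(2) by (auto simp: Linf_def intro: measurable_restrict_space1)
  have "AE x in lebesgue_on UNIV. 0 \<le> \<rho>\<^sub>0 x \<and> \<rho>\<^sub>0 x \<le> 1"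
    using assms(2) by (simp add: Linf_def)
  from AE_lebesgue_on_subset[OF this]
  have "AE x in lebesgue_on {xface dx j..xface dx (j + 1)}. 0 \<le> \<rho>\<^sub>0 x \<and> \<rho>\<^sub>0 x \<le> 1"
    by auto
  from set_integral_Icc_bounds[OF le m this] show ?thesis
    using assms(1) by (simp add: d cell_average_def)
qed

lemma time_average_bounds:
  assumes "0 < dt" "real (n + 1) * dt \<le> T"
    and q: "q \<in> Linf {0..} {0..}" "Linf_norm {0..T} q \<le> ereal c"
  shows "0 \<le> time_average dt q n" "time_average dt q n \<le> c"
proof -
  let ?I = "{real n * dt..real (n + 1) * dt}"
  have le: "real n * dt \<le> real (n + 1) * dt" and d: "real (n + 1) * dt - real n * dt = dt"
    using assms(1) by (auto simp: algebra_simps)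
  have I: "?I \<subseteq> {0..}" "?I \<subseteq> {0..T}"
    using assms(1,2) by (auto intro: order_trans[rotated])
  have "q \<in> borel_measurable (lebesgue_on {0..})"
    using q by (simp add: Linf_def)
  then have m: "q \<in> borel_measurable (lebesgue_on ?I)"
    by (rule measurable_restrict_mono) (rule I(1))
  have "AE x in lebesgue_on {0..}. 0 \<le> q x"
    using q by (simp add: Linf_def)
  then have "AE x in lebesgue_on ?I. 0 \<le> q x"
    by (rule AE_lebesgue_on_subset) (use I in auto)
  moreover have "AE x in lebesgue_on ?I. \<bar>q x\<bar> \<le> c"
    using AE_abs_le_of_Linf_norm_le[OF q(2)] I(2) by (rule AE_lebesgue_on_subset) auto
  ultimately have "AE x in lebesgue_on ?I. 0 \<le> q x \<and> q x \<le> c"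
    by eventually_elim auto
  from set_integral_Icc_bounds[OF le m this] show "0 \<le> time_average dt q n" "time_average dt q n \<le> c"
    using assms(1) unfolding d time_average_def by (auto simp: field_simps)
qed

lemma antimono_on_of_deriv_on_nonpos:
  assumes "f differentiable_on {a..b}" "\<forall>y\<in>{a..b}. deriv_on {a..b} f y \<le> 0"
    and "a \<le> x" "x \<le> y" "y \<le> b"
  shows "f y \<le> f x"
proof (cases "x = y")
  case False
  then have "x < y"
    using assms by simp
  then show ?thesis
  proof (rule DERIV_nonpos_imp_decreasing_open[OF less_imp_le])
    fix z assume z: "x < z" "z < y"
    then have at: "at z within {a..b} = at z"
      using assms by (intro at_within_Icc_at) auto
    have "f differentiable (at z)"
      using assms z by (auto simp: differentiable_on_def at[symmetric])
    then have "(f has_vector_derivative vector_derivative f (at z)) (at z)"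
      by (simp add: vector_derivative_works)
    moreover have "vector_derivative f (at z) \<le> 0"
      using assms(2)[rule_format, of z] assms(3-) z at by (simp add: deriv_on_def)
    ultimately show "\<exists>d. (f has_real_derivative d) (at z) \<and> d \<le> 0"
      by (auto simp: has_real_derivative_iff_has_vector_derivative)
  next
    show "continuous_on {x..y} f"
      by (rule continuous_on_subset[OF differentiable_imp_continuous_on[OF assms(1)]])
        (use assms in auto)
  qed
qed simp

text \<open>For a decreasing kernel the value at the common face of two cells separates the two weights:
  \<open>\<gamma>\<^sub>p\<^sub>+\<^sub>1 \<le> dx w((p + 1) dx) \<le> \<gamma>\<^sub>p\<close>.\<close>

lemma conv_weight_props:
  assumes "0 < dx" "b = real N * dx"
    and w: "Ck_on 1 {0..b} w" "\<forall>y\<in>{0..b}. 0 \<le> w y" "\<forall>y\<in>{0..b}. deriv_on {0..b} w y \<le> 0"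
  shows conv_weight_nonneg: "p < N \<Longrightarrow> 0 \<le> conv_weight dx w p"
    and conv_weight_antimono: "Suc p < N \<Longrightarrow> conv_weight dx w (Suc p) \<le> conv_weight dx w p"
    and sum_conv_weight_le: "(\<Sum>p<N. conv_weight dx w p) \<le> (LINT y:{0..b}|lebesgue. w y)"
proof -
  have diff: "w differentiable_on {0..b}"
    using w by (simp add: numeral_eq_Suc)
  then have cont: "continuous_on {0..b} w"
    by (rule differentiable_imp_continuous_on)
  have sub: "{real p * dx..real (p + 1) * dx} \<subseteq> {0..b}" if "p < N" for p
  proof -
    have "real (p + 1) * dx \<le> b"
      unfolding assms(2) using that assms(1) by (intro mult_right_mono) auto
    then show ?thesis
      using assms(1) by (auto intro: order_trans[rotated])
  qed
  have bounds: "w (real (p + 1) * dx) * dx \<le> conv_weight dx w p"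
    "conv_weight dx w p \<le> w (real p * dx) * dx" if "p < N" for p
  proof -
    let ?I = "{real p * dx..real (p + 1) * dx}"
    have le: "real p * dx \<le> real (p + 1) * dx" and d: "real (p + 1) * dx - real p * dx = dx"
      using assms(1) by (auto simp: algebra_simps)
    have m: "w \<in> borel_measurable (lebesgue_on ?I)"
      using continuous_on_subset[OF cont sub[OF that]]
      by (intro continuous_imp_measurable_on_sets_lebesgue) auto
    have "w (real (p + 1) * dx) \<le> w x \<and> w x \<le> w (real p * dx)" if "x \<in> ?I" for x
      using that sub[OF \<open>p < N\<close>] le
      by (intro conjI antimono_on_of_deriv_on_nonpos[OF diff w(3)])
        (auto simp: subset_iff)
    then have "AE x in lebesgue_on ?I. w (real (p + 1) * dx) \<le> w x \<and> w x \<le> w (real p * dx)"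
      by (auto intro!: AE_I2)
    from set_integral_Icc_bounds[OF le m this]
    show "w (real (p + 1) * dx) * dx \<le> conv_weight dx w p"
      "conv_weight dx w p \<le> w (real p * dx) * dx"
      unfolding d conv_weight_def by simp_all
  qed
  show "0 \<le> conv_weight dx w p" if "p < N"
  proof -
    have "real (p + 1) * dx \<in> {real p * dx..real (p + 1) * dx}"
      using assms(1) by (auto simp: algebra_simps)
    then have "0 \<le> w (real (p + 1) * dx)"
      using sub[OF that] w(2) by blast
    then show ?thesis
      using bounds(1)[OF that] assms(1) mult_nonneg_nonneg[of "w (real (p + 1) * dx)" dx] by linarith
  qed
  show "conv_weight dx w (Suc p) \<le> conv_weight dx w p" if "Suc p < N"
    using bounds(1)[of p] bounds(2)[OF that] that by simp
  let ?g = "\<lambda>y. if y \<in> {0..b} then w y else 0"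
  have "(\<Sum>p<N. conv_weight dx w p)
      = (\<Sum>p<N. LINT x:{real_of_int (int p) * dx..real_of_int (int p + 1) * dx}|lebesgue. ?g x)"
  proof (rule sum.cong)
    fix p assume "p \<in> {..<N}"
    then show "conv_weight dx w p
        = (LINT x:{real_of_int (int p) * dx..real_of_int (int p + 1) * dx}|lebesgue. ?g x)"
      unfolding conv_weight_def set_lebesgue_integral_def
      using sub[of p] by (intro Bochner_Integration.integral_cong)
        (auto simp: add.commute split: split_indicator)
  qed simp
  also have "\<dots> = (\<Sum>h\<in>int ` {..<N}. LINT x:{real_of_int h * dx..real_of_int (h + 1) * dx}|lebesgue. ?g x)"
    by (subst sum.reindex) auto
  also have "\<dots> \<le> integral\<^sup>L lebesgue ?g"
    using assms(1) w(2) integral_zero_extension(1)[OF cont]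
    by (intro sum_cell_integrals_le) auto
  finally show "(\<Sum>p<N. conv_weight dx w p) \<le> (LINT y:{0..b}|lebesgue. w y)"
    by (simp only: integral_zero_extension(2)[OF cont])
qed

text \<open>The summation range is rounded to whole cells when \<open>\<delta>\<close> is not a multiple of \<open>dx\<close>, so the
  weights may miss some mass of the kernel, but by the extension by zero they never exceed it.\<close>

lemma R_on_le:
  assumes "0 < dx" and w: "continuous_on {\<delta> - \<eta>..\<delta> + \<eta>} w" "\<forall>y\<in>{\<delta> - \<eta>..\<delta> + \<eta>}. 0 \<le> w y"
    and r: "\<And>j. r j \<le> 1"
  shows "R_on dx \<eta> \<delta> w r j \<le> (LINT y:{\<delta> - \<eta>..\<delta> + \<eta>}|lebesgue. w y)"
proof -
  let ?H = "{\<lfloor>(\<delta> - \<eta>) / dx\<rfloor>..\<lfloor>(\<delta> + \<eta>) / dx\<rfloor> - 1}"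
  have "0 \<le> ramp_weight dx \<eta> \<delta> w h" for h
    unfolding ramp_weight_def set_lebesgue_integral_def
    using w(2) by (intro integral_nonneg_AE AE_I2) auto
  then have "R_on dx \<eta> \<delta> w r j \<le> (\<Sum>h\<in>?H. ramp_weight dx \<eta> \<delta> w h)"
    unfolding R_on_def using r by (intro sum_mono mult_left_le) auto
  also have "\<dots> \<le> integral\<^sup>L lebesgue (\<lambda>y. if y \<in> {\<delta> - \<eta>..\<delta> + \<eta>} then w y else 0)"
    unfolding ramp_weight_def using assms(1) w(2) integral_zero_extension(1)[OF w(1)]
    by (intro sum_cell_integrals_le) auto
  finally show ?thesis
    by (simp only: integral_zero_extension(2)[OF w(1)])
qed

section \<open>The two substeps\<close>

text \<open>Summation by parts in the form of an inequality: the increments of \<open>s\<close> are those of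
  \<open>-(1 - s)\<close>, and passing from \<open>\<gamma>\<^sub>p\<close> to the smaller \<open>\<gamma>\<^sub>p\<^sub>+\<^sub>1\<close> in front of \<open>1 - s\<^sub>p\<^sub>+\<^sub>1 \<ge> 0\<close> only
  loses. The last term is kept to make the induction go through.\<close>

lemma sum_antimono_weights_increments_le:
  fixes \<gamma> s :: "nat \<Rightarrow> real"
  assumes "\<And>p. p < m \<Longrightarrow> \<gamma> (Suc p) \<le> \<gamma> p" "\<And>p. s p \<le> 1"
  shows "(\<Sum>p<Suc m. \<gamma> p * (s (Suc p) - s p)) \<le> \<gamma> 0 * (1 - s 0) - \<gamma> m * (1 - s (Suc m))"
  using assms(1)
proof (induction m)
  case 0
  then show ?case by (simp add: algebra_simps)
next
  case (Suc m)
  have "\<gamma> (Suc m) * (1 - s (Suc m)) \<le> \<gamma> m * (1 - s (Suc m))"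
    using Suc.prems[of m] assms(2) by (intro mult_right_mono) auto
  moreover have "(\<Sum>p<Suc m. \<gamma> p * (s (Suc p) - s p)) \<le> \<gamma> 0 * (1 - s 0) - \<gamma> m * (1 - s (Suc m))"
    using Suc by simp
  ultimately show ?case
    by (simp add: algebra_simps)
qed

text \<open>Moving the window one cell downstream drops \<open>r\<^sub>j\<close> with its weight \<open>\<gamma>\<^sub>0\<close>. The values further
  downstream gain the nonnegative weights \<open>\<gamma>\<^sub>p\<^sub>-\<^sub>1 - \<gamma>\<^sub>p\<close>, which with the \<open>\<gamma>\<^sub>N\<^sub>-\<^sub>1\<close> of the value that
  enters add up to \<open>\<gamma>\<^sub>0\<close>, and these values are at most one.\<close>

lemma R_down_increment_le:
  assumes "0 < N" "\<And>p. p < N \<Longrightarrow> 0 \<le> conv_weight dx w p"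
    and "\<And>p. Suc p < N \<Longrightarrow> conv_weight dx w (Suc p) \<le> conv_weight dx w p"
    and r: "\<And>j. r j \<le> 1"
  shows "R_down dx N w r j - R_down dx N w r (j - 1) \<le> conv_weight dx w 0 * (1 - r j)"
proof -
  obtain m where N: "N = Suc m"
    using \<open>0 < N\<close> gr0_implies_Suc by blast
  let ?\<gamma> = "conv_weight dx w" and ?s = "\<lambda>p. r (j + int p)"
  have "R_down dx N w r j - R_down dx N w r (j - 1) = (\<Sum>p<N. ?\<gamma> p * (?s (Suc p) - ?s p))"
    unfolding R_down_def sum_subtractf[symmetric]
    by (intro sum.cong) (auto simp: algebra_simps)
  also have "\<dots> \<le> ?\<gamma> 0 * (1 - ?s 0) - ?\<gamma> m * (1 - ?s (Suc m))"
    unfolding N by (rule sum_antimono_weights_increments_le) (use assms N in auto)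
  also have "\<dots> \<le> ?\<gamma> 0 * (1 - ?s 0)"
    using assms(2)[of m] r N by simp
  finally show ?thesis by simp
qed

lemma R_down_in_unit:
  assumes "\<And>p. p < N \<Longrightarrow> 0 \<le> conv_weight dx w p" "(\<Sum>p<N. conv_weight dx w p) \<le> 1"
    and r: "\<And>j. r j \<in> {0..1}"
  shows "R_down dx N w r j \<in> {0..1}"
proof -
  have "R_down dx N w r j \<le> (\<Sum>p<N. conv_weight dx w p)"
    unfolding R_down_def using assms(1) r by (intro sum_mono mult_left_le) auto
  moreover have "0 \<le> R_down dx N w r j"
    unfolding R_down_def using assms(1) r by (intro sum_nonneg mult_nonneg_nonneg) auto
  ultimately show ?thesis
    using assms(2) by simp
qed

text \<open>The constants \<open>A\<close> and \<open>B\<close> stand for the supremum norms of \<open>v'\<close> and \<open>v\<close> on \<open>[0,1]\<close>. The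
  one-sided form of the Lipschitz condition encodes that \<open>v\<close> is nonincreasing as well.\<close>

lemma transport_step_in_unit:
  assumes "0 < dx" "0 < dt" "0 < N"
    and \<gamma>: "\<And>p. p < N \<Longrightarrow> 0 \<le> conv_weight dx w p"
      "\<And>p. Suc p < N \<Longrightarrow> conv_weight dx w (Suc p) \<le> conv_weight dx w p"
      "(\<Sum>p<N. conv_weight dx w p) \<le> 1"
    and v: "\<And>x. x \<in> {0..1} \<Longrightarrow> 0 \<le> v x" "\<And>x. x \<in> {0..1} \<Longrightarrow> v x \<le> B"
      "\<And>x y. x \<in> {0..1} \<Longrightarrow> y \<in> {0..1} \<Longrightarrow> v x - v y \<le> A * max 0 (y - x)"
    and "0 \<le> A" and CFL: "dt * (conv_weight dx w 0 * A + B) \<le> dx"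
    and r: "\<And>j. r j \<in> {0..1}"
  shows "transport_step dx dt N w v r j \<in> {0..1}"
proof -
  define \<kappa> where "\<kappa> = dt / dx"
  define g where "g = conv_weight dx w 0"
  define V where "V i = v (R_down dx N w r i)" for i
  have R: "R_down dx N w r i \<in> {0..1}" for i
    using R_down_in_unit[OF \<gamma>(1,3) r] .
  have \<kappa>: "0 \<le> \<kappa>" "\<kappa> * (g * A + B) \<le> 1"
    using assms(1,2) CFL by (auto simp: \<kappa>_def g_def field_simps)
  have g: "0 \<le> g"
    using \<gamma>(1)[of 0] \<open>0 < N\<close> by (simp add: g_def)
  have V: "0 \<le> V i" "V i \<le> B" for i
    using v(1,2)[OF R] by (auto simp: V_def)
  have rj: "0 \<le> r i" "r i \<le> 1" for i
    using r[of i] by auto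
  have eq: "transport_step dx dt N w v r j = r j * (1 - \<kappa> * V j) + \<kappa> * (r (j - 1) * V (j - 1))"
    by (simp add: transport_step_def \<kappa>_def V_def algebra_simps)
  have "\<kappa> * V j \<le> \<kappa> * (g * A + B)"
    using \<kappa>(1) V(2)[of j] g \<open>0 \<le> A\<close> by (intro mult_left_mono) (auto intro: add_increasing)
  then have "\<kappa> * V j \<le> 1"
    using \<kappa>(2) by simp
  then have "0 \<le> transport_step dx dt N w v r j"
    unfolding eq using rj V \<kappa>(1) by (intro add_nonneg_nonneg mult_nonneg_nonneg) auto
  moreover have "transport_step dx dt N w v r j \<le> 1"
  proof -
    have "V (j - 1) - V j \<le> A * max 0 (R_down dx N w r j - R_down dx N w r (j - 1))"
      unfolding V_def by (rule v(3)[OF R R])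
    also have "\<dots> \<le> A * (g * (1 - r j))"
      using R_down_increment_le[where r = r and j = j, OF \<open>0 < N\<close> \<gamma>(1,2) rj(2)] g rj(2)[of j] \<open>0 \<le> A\<close>
      by (intro mult_left_mono) (auto simp: g_def)
    finally have dV: "V (j - 1) \<le> V j + A * (g * (1 - r j))" by simp
    (* The upstream density is replaced by its maximal value 1. *)
    have "r (j - 1) * V (j - 1) \<le> V (j - 1)"
      using rj V by (intro mult_left_le_one_le) auto
    with dV have "\<kappa> * (r (j - 1) * V (j - 1)) \<le> \<kappa> * (V j + A * (g * (1 - r j)))"
      using \<kappa>(1) by (intro mult_left_mono) auto
    then have "transport_step dx dt N w v r j \<le> r j + \<kappa> * (g * A + V j) * (1 - r j)"
      unfolding eq by (simp add: algebra_simps)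
    also have "\<dots> \<le> r j + \<kappa> * (g * A + B) * (1 - r j)"
      using \<kappa>(1) V(2)[of j] rj(2)[of j] by (intro add_left_mono mult_right_mono mult_left_mono) auto
    also have "\<dots> \<le> r j + 1 * (1 - r j)"
      using \<kappa>(2) rj(2)[of j] by (intro add_left_mono mult_right_mono) auto
    finally show ?thesis by simp
  qed
  ultimately show ?thesis by simp
qed

text \<open>The fractions \<open>\<alpha>\<close> and \<open>\<beta>\<close> of the free and of the occupied space that are exchanged with
  the ramps are at most one, because the indicator of a ramp is at most the inverse of its
  length.\<close>

lemma source_step_in_unit:
  assumes "0 \<le> dt" "0 < dx" "1 \<le> l" "0 \<le> a" "0 \<le> b"
    and CFL: "dt * (a + b) \<le> ramp_length dx l"
    and r: "r j \<in> {0..1}" and R: "R_on dx \<eta> \<delta> w r j \<le> 1"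
  shows "source_step dx dt \<eta> \<delta> w l k_on k_off a b r j \<in> {0..1}"
proof -
  define \<alpha> where "\<alpha> = dt * ramp_ind dx l k_on j * a"
  define \<beta> where "\<beta> = dt * ramp_ind dx l k_off j * b"
  have L: "0 < ramp_length dx l"
    using assms by (simp add: ramp_length_def)
  have ineqs: "dt * a \<le> ramp_length dx l" "dt * b \<le> ramp_length dx l"
    using CFL mult_nonneg_nonneg[OF assms(1,4)] mult_nonneg_nonneg[OF assms(1,5)]
    by (auto simp: algebra_simps)
  have \<alpha>: "0 \<le> \<alpha>" "\<alpha> \<le> 1"
    using L ineqs assms(1,4) by (auto simp: \<alpha>_def ramp_ind_def field_simps)
  have \<beta>: "0 \<le> \<beta>" "\<beta> \<le> 1"
    using L ineqs assms(1,5) by (auto simp: \<beta>_def ramp_ind_def field_simps)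
  let ?m = "max (r j) (R_on dx \<eta> \<delta> w r j)"
  have eq: "source_step dx dt \<eta> \<delta> w l k_on k_off a b r j = r j + \<alpha> * (1 - ?m) - \<beta> * r j"
    by (simp add: source_step_def \<alpha>_def \<beta>_def)
  have "0 \<le> \<alpha> * (1 - ?m)" "\<beta> * r j \<le> r j" "0 \<le> \<beta> * r j"
    using \<alpha> \<beta> r R by (auto intro!: mult_nonneg_nonneg mult_left_le_one_le)
  moreover have "\<alpha> * (1 - ?m) \<le> 1 * (1 - r j)"
    using \<alpha> r R by (intro mult_mono) auto
  ultimately show ?thesis
    unfolding eq using r by auto
qed

section \<open>Invariance of the unit interval\<close>

lemma velocity_decrease_le:
  assumes v: "Ck_on 2 UNIV v" "\<forall>x. deriv_on UNIV v x \<le> 0"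
    and A: "\<And>x. x \<in> {0..1} \<Longrightarrow> \<bar>deriv_on UNIV v x\<bar> \<le> A"
    and xy: "x \<in> {0..1}" "y \<in> {0..1}"
  shows "v x - v y \<le> A * max 0 (y - x)"
proof -
  have D: "(v has_real_derivative deriv_on UNIV v z) (at z)" for z
    using v(1) by (auto simp: numeral_eq_Suc differentiable_on_def deriv_on_def
        has_real_derivative_iff_has_vector_derivative vector_derivative_works)
  show ?thesis
  proof (cases "x < y")
    case True
    then obtain z where z: "x < z" "z < y" "v y - v x = (y - x) * deriv_on UNIV v z"
      using MVT2[of x y v "deriv_on UNIV v"] D by blast
    have "- deriv_on UNIV v z \<le> A"
      using A[of z] z xy by auto
    then have "(y - x) * (- deriv_on UNIV v z) \<le> (y - x) * A"
      using True by (intro mult_left_mono) auto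
    then show ?thesis
      using z(3) True by (simp add: algebra_simps)
  next
    case False
    then have "v x \<le> v y"
      using D v(2) by (intro DERIV_nonpos_imp_nonincreasing[of y x v]) auto
    then show ?thesis
      using False by simp
  qed
qed

lemma piecewise_constant_value:
  assumes "0 < dx" "0 < dt" "T < real (N\<^sub>T + 1) * dt"
    and u: "piecewise_constant T dx dt N\<^sub>T r u" and t: "t \<in> {0..T}"
  obtains n j where "n \<le> N\<^sub>T" "u t x = r n j"
proof -
  define n where "n = nat \<lfloor>t / dt\<rfloor>"
  define j where "j = \<lceil>x / dx\<rceil> - 1"
  have n: "real n = real_of_int \<lfloor>t / dt\<rfloor>"
    using t assms(2) by (simp add: n_def)
  have "real n \<le> t / dt" "t / dt < real n + 1"
    unfolding n by linarith+
  then have t1: "real n * dt \<le> t" "t < real (n + 1) * dt"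
    using assms(2) by (auto simp: field_simps)
  have "real n * dt < real (N\<^sub>T + 1) * dt"
    using t1(1) t assms(3) by simp
  then have "n \<le> N\<^sub>T"
    using assms(2) by (simp only: mult_less_cancel_right_pos of_nat_less_iff)
  have "real_of_int j < x / dx" "x / dx \<le> real_of_int (j + 1)"
    unfolding j_def by linarith+
  then have "xface dx j < x" "x \<le> xface dx (j + 1)"
    using assms(1) by (auto simp: field_simps xface_def)
  then have "u t x = r n j"
    using u \<open>n \<le> N\<^sub>T\<close> t t1 unfolding piecewise_constant_def by auto
  with \<open>n \<le> N\<^sub>T\<close> show thesis by (rule that)
qed

theorem lemma3p5:
  fixes T \<eta> \<delta> dx dt :: real
    and q_on q_off v w w_on \<rho>\<^sub>0 :: "real \<Rightarrow> real"
    and N N\<^sub>T :: nat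
    and k_on k_off l :: int
    and \<rho>\<^sub>\<Delta> :: "real \<Rightarrow> real \<Rightarrow> real"
  assumes T: "0 < T"
    and q_on: "q_on \<in> Linf {0..} {0..}"
    and q_off: "q_off \<in> Linf {0..} {0..}"
    and v: "Ck_on 2 UNIV v" "\<forall>x. v x \<in> {0..1}" "\<forall>x. deriv_on UNIV v x \<le> 0"
    and \<eta>: "\<eta> \<in> {0<..1}" and \<delta>: "\<delta> \<in> {-\<eta>..\<eta>}"
    and w: "Ck_on 1 {0..\<eta>} w" "\<forall>y\<in>{0..\<eta>}. 0 \<le> w y"
      "\<forall>y\<in>{0..\<eta>}. deriv_on {0..\<eta>} w y \<le> 0"
      "set_lebesgue_integral lebesgue {0..\<eta>} w = 1"
    and w_on: "Ck_on 1 {\<delta> - \<eta>..\<delta> + \<eta>} w_on" "\<forall>y\<in>{\<delta> - \<eta>..\<delta> + \<eta>}. 0 \<le> w_on y"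
      "\<forall>y\<in>{\<delta> - \<eta>..0}. 0 \<le> deriv_on {\<delta> - \<eta>..\<delta> + \<eta>} w_on y"
      "\<forall>y\<in>{0..\<delta> + \<eta>}. deriv_on {\<delta> - \<eta>..\<delta> + \<eta>} w_on y \<le> 0"
      "set_lebesgue_integral lebesgue {\<delta> - \<eta>..\<delta> + \<eta>} w_on = 1"
    and mesh: "0 < dx" "\<eta> = real N * dx" "0 < dt"
      "real N\<^sub>T * dt \<le> T" "T < real (N\<^sub>T + 1) * dt"
    and l: "1 \<le> l"
    and \<rho>\<^sub>0: "\<rho>\<^sub>0 \<in> Linf UNIV {0..1}"
    and CFL: "ereal dt \<le>
      min (ereal dx / (ereal (conv_weight dx w 0) * Linf_norm {0..1} (deriv_on UNIV v)
                         + Linf_norm {0..1} v))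
          (ereal (ramp_length dx l) / (Linf_norm {0..T} q_on + Linf_norm {0..T} q_off))"
    and \<rho>\<^sub>\<Delta>: "piecewise_constant T dx dt N\<^sub>T
      (model2_density dx dt N \<eta> \<delta> w w_on v l k_on k_off q_on q_off \<rho>\<^sub>0) \<rho>\<^sub>\<Delta>"
  shows "\<forall>t\<in>{0..T}. \<forall>x. 0 \<le> \<rho>\<^sub>\<Delta> t x \<and> \<rho>\<^sub>\<Delta> t x \<le> 1"
proof -
  let ?\<gamma> = "conv_weight dx w" and ?v' = "deriv_on UNIV v"
  let ?\<rho> = "model2_density dx dt N \<eta> \<delta> w w_on v l k_on k_off q_on q_off \<rho>\<^sub>0"
  have N: "0 < N"
    using \<eta> mesh(2) by (cases N) auto
  note \<gamma> = conv_weight_props[OF mesh(1,2) w(1,2,3)]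
  have \<gamma>_sum: "(\<Sum>p<N. ?\<gamma> p) \<le> 1"
    using \<gamma>(3) w(4) by simp
  have \<gamma>0: "0 \<le> ?\<gamma> 0"
    by (rule \<gamma>(1)[OF N])
  have "v differentiable_on UNIV" "?v' differentiable_on UNIV"
    using v(1) by (simp_all add: numeral_eq_Suc)
  then have cont: "continuous_on {0..1} v" "continuous_on {0..1} ?v'"
    by (auto intro: continuous_on_subset differentiable_imp_continuous_on)
  obtain A where A: "Linf_norm {0..1} ?v' = ereal A" "0 \<le> A"
    using Linf_norm_finite_of_continuous[OF cont(2)] Linf_norm_nonneg[of 0 1 ?v']
    by (cases "Linf_norm {0..1} ?v'") auto
  obtain B where B: "Linf_norm {0..1} v = ereal B" "0 \<le> B"
    using Linf_norm_finite_of_continuous[OF cont(1)] Linf_norm_nonneg[of 0 1 v]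
    by (cases "Linf_norm {0..1} v") auto
  have CFL_v: "dt * (?\<gamma> 0 * A + B) \<le> dx"
    using CFL A B \<gamma>0 mesh by (intro mult_le_of_le_ereal_divide) auto
  let ?qa = "Linf_norm {0..T} q_on" and ?qb = "Linf_norm {0..T} q_off"
  have q_nonneg: "0 \<le> ?qa" "0 \<le> ?qb"
    using Linf_norm_nonneg[OF T] by auto
  have CFL_q: "ereal dt \<le> ereal (ramp_length dx l) / (?qa + ?qb)"
    using CFL by simp
  (* An infinite norm would make the right-hand side zero and contradict dt > 0. *)
  have "?qa + ?qb \<noteq> \<infinity>"
    using CFL_q mesh(3) by auto
  then obtain a b where ab: "?qa = ereal a" "?qb = ereal b" "0 \<le> a" "0 \<le> b"
    using q_nonneg by (cases "?qa"; cases "?qb") auto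
  have L: "0 \<le> ramp_length dx l"
    using mesh(1) l by (simp add: ramp_length_def)
  have CFL_ab: "dt * (a + b) \<le> ramp_length dx l"
    using CFL_q ab L mesh(3) by (intro mult_le_of_le_ereal_divide) auto
  have v_le: "v x \<le> B" if "x \<in> {0..1}" for x
    using abs_le_of_Linf_norm_le[OF _ cont(1) _ that, of B] B by auto
  have v'_le: "\<bar>?v' x\<bar> \<le> A" if "x \<in> {0..1}" for x
    using abs_le_of_Linf_norm_le[OF _ cont(2) _ that, of A] A by auto
  have cont_on: "continuous_on {\<delta> - \<eta>..\<delta> + \<eta>} w_on"
    using w_on(1) by (auto intro: differentiable_imp_continuous_on)
  have invariant: "?\<rho> n j \<in> {0..1}" if "n \<le> N\<^sub>T" for n j
    using that
  proof (induction n arbitrary: j)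
    case 0
    then show ?case
      using cell_average_in_unit[OF mesh(1) \<rho>\<^sub>0] by simp
  next
    case (Suc n)
    let ?r = "transport_step dx dt N w v (?\<rho> n)"
    let ?a = "time_average dt q_on n" and ?b = "time_average dt q_off n"
    have r: "?r j \<in> {0..1}" for j
      using v(2) Suc
      by (intro transport_step_in_unit[where A = A and B = B] mesh N \<gamma> \<gamma>_sum A CFL_v v_le
          velocity_decrease_le[OF v(1,3) v'_le]) auto
    have "real (n + 1) * dt \<le> real N\<^sub>T * dt"
      using Suc.prems mesh(3) by (intro mult_right_mono) auto
    then have step: "real (n + 1) * dt \<le> T"
      using mesh(4) by simp
    have qs: "0 \<le> ?a" "?a \<le> a" "0 \<le> ?b" "?b \<le> b"
      using time_average_bounds[OF mesh(3) step q_on, of a]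
        time_average_bounds[OF mesh(3) step q_off, of b] ab by auto
    then have "dt * (?a + ?b) \<le> dt * (a + b)"
      using mesh(3) by (intro mult_left_mono) auto
    then have "dt * (?a + ?b) \<le> ramp_length dx l"
      using CFL_ab by simp
    moreover have "R_on dx \<eta> \<delta> w_on ?r j \<le> 1"
      using R_on_le[OF mesh(1) cont_on w_on(2), of ?r j] r w_on(5) by auto
    ultimately show ?case
      using source_step_in_unit[of dt dx l ?a ?b ?r j] mesh l qs r by simp
  qed
  show ?thesis
  proof (intro ballI allI)
    fix t x assume "t \<in> {0..T}"
    then obtain n j where "n \<le> N\<^sub>T" "\<rho>\<^sub>\<Delta> t x = ?\<rho> n j"
      using piecewise_constant_value[OF mesh(1,3,5) \<rho>\<^sub>\<Delta>] by blast
    then show "0 \<le> \<rho>\<^sub>\<Delta> t x \<and> \<rho>\<^sub>\<Delta> t x \<le> 1"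
      using invariant[of n j] by simp
  qed
qed

end
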